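(* For every positive integer $n$, the number $\lambda(n)$ of isomorphism classes of linear $L$-algebras with exactly $n$ elements equals the Bell number $B(n-1)$, i.e. the number of partitions of a set with $n-1$ elements into non-empty subsets (with $B(0)=1$).
   Context: An $L$-algebra is a set $X$ together with a binary operation $(x,y)\mapsto x\cdot y$ such that: (i) there exists $e\in X$ with $e\cdot x=x$ and $x\cdot e=x\cdot x=e$ for all $x\in X$; (ii) $(x\cdot y)\cdot(x\cdot z)=(y\cdot x)\cdot(y\cdot z)$ for all $x,y,z\in X$; (iii) if $x\cdot y=y\cdot x=e$, then $x=y$. The natural order is the partial order $x\le y\iff x\cdot y=e$. An $L$-algebra is linear if for all $x,y\in X$, $x\le y$ or $y\le x$. An isomorphism of $L$-algebras is a bijection $f$ with $f(x\cdot y)=f(x)\cdot f(y)$ for all $x,y$. *)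

theory Defs
  imports Main "HOL-Library.Disjoint_Sets"
begin

definition logical_unit :: "'a set \<Rightarrow> ('a \<Rightarrow> 'a \<Rightarrow> 'a) \<Rightarrow> 'a \<Rightarrow> bool" where
  "logical_unit X f e \<longleftrightarrow>
     e \<in> X \<and> (\<forall>x\<in>X. f e x = x \<and> f x e = e \<and> f x x = e)"

definition L_algebra :: "'a set \<Rightarrow> ('a \<Rightarrow> 'a \<Rightarrow> 'a) \<Rightarrow> bool" where
  "L_algebra X f \<longleftrightarrow>
     (\<forall>x\<in>X. \<forall>y\<in>X. f x y \<in> X) \<and>
     (\<forall>x\<in>X. \<forall>y\<in>X. \<forall>z\<in>X. f (f x y) (f x z) = f (f y x) (f y z)) \<and>
     (\<exists>e. logical_unit X f e \<and> (\<forall>x\<in>X. \<forall>y\<in>X. f x y = e \<and> f y x = e \<longrightarrow> x = y))"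

definition L_unit :: "'a set \<Rightarrow> ('a \<Rightarrow> 'a \<Rightarrow> 'a) \<Rightarrow> 'a" where
  "L_unit X f = (THE e. logical_unit X f e)"

definition L_le :: "'a set \<Rightarrow> ('a \<Rightarrow> 'a \<Rightarrow> 'a) \<Rightarrow> 'a \<Rightarrow> 'a \<Rightarrow> bool" where
  "L_le X f x y \<longleftrightarrow> f x y = L_unit X f"

definition linear_L_algebra :: "'a set \<Rightarrow> ('a \<Rightarrow> 'a \<Rightarrow> 'a) \<Rightarrow> bool" where
  "linear_L_algebra X f \<longleftrightarrow>
     L_algebra X f \<and> (\<forall>x\<in>X. \<forall>y\<in>X. L_le X f x y \<or> L_le X f y x)"

definition L_isomorphic ::
    "'a set \<times> ('a \<Rightarrow> 'a \<Rightarrow> 'a) \<Rightarrow> 'b set \<times> ('b \<Rightarrow> 'b \<Rightarrow> 'b) \<Rightarrow> bool" where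
  "L_isomorphic = (\<lambda>(X, f) (Y, g).
     \<exists>h. bij_betw h X Y \<and> (\<forall>x\<in>X. \<forall>y\<in>X. h (f x y) = g (h x) (h y)))"

text \<open>
  The carriers range over all \<open>n\<close>-element sets of natural numbers. This loses nothing: by
  \<open>linear_L_algebra_nat_copy\<close> below, every finite linear \<open>L\<close>-algebra, over any type, is isomorphic
  to one of these. The values of an operation outside its carrier are irrelevant, since operations
  that agree on the carrier give isomorphic structures and hence the same class.
\<close>

definition linear_L_algebras :: "nat \<Rightarrow> (nat set \<times> (nat \<Rightarrow> nat \<Rightarrow> nat)) set" where
  "linear_L_algebras n = {(X, f). finite X \<and> card X = n \<and> linear_L_algebra X f}"

definition L_iso_rel ::
    "nat \<Rightarrow> ((nat set \<times> (nat \<Rightarrow> nat \<Rightarrow> nat)) \<times> (nat set \<times> (nat \<Rightarrow> nat \<Rightarrow> nat))) set" where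
  "L_iso_rel n =
     {(A, B). A \<in> linear_L_algebras n \<and> B \<in> linear_L_algebras n \<and> L_isomorphic A B}"

definition num_linear_L_algebras :: "nat \<Rightarrow> nat" where
  "num_linear_L_algebras n = card (linear_L_algebras n // L_iso_rel n)"

definition Bell :: "nat \<Rightarrow> nat" where
  "Bell n = card {P. partition_on {..<n} P}"

lemma Bell_0: "Bell 0 = 1"
proof -
  have "{P :: nat set set. partition_on {..<0} P} = {{}}"
    by (auto simp: partition_on_def)
  then show ?thesis by (simp add: Bell_def)
qed

lemma logical_unit_unique:
  assumes "logical_unit X f e" "logical_unit X f e'"
  shows "e = e'"
  using assms unfolding logical_unit_def by metis

lemma L_unit_eq:
  assumes "logical_unit X f e"
  shows "L_unit X f = e"
  unfolding L_unit_def using assms logical_unit_unique by (metis the_equality)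

lemma L_isomorphic_refl: "L_isomorphic A A"
  unfolding L_isomorphic_def by (auto intro!: exI[of _ id] split: prod.split)

lemma L_isomorphic_trans:
  assumes "L_isomorphic A B" "L_isomorphic B C"
  shows "L_isomorphic A C"
proof -
  obtain X f Y g Z k where eq: "A = (X, f)" "B = (Y, g)" "C = (Z, k)"
    by (metis surj_pair)
  obtain h1 h2 where
    h1: "bij_betw h1 X Y" "\<forall>x\<in>X. \<forall>y\<in>X. h1 (f x y) = g (h1 x) (h1 y)" and
    h2: "bij_betw h2 Y Z" "\<forall>x\<in>Y. \<forall>y\<in>Y. h2 (g x y) = k (h2 x) (h2 y)"
    using assms unfolding eq L_isomorphic_def by auto
  have "bij_betw (h2 \<circ> h1) X Z" using h1(1) h2(1) by (rule bij_betw_trans)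
  moreover have "\<forall>x\<in>X. \<forall>y\<in>X. (h2 \<circ> h1) (f x y) = k ((h2 \<circ> h1) x) ((h2 \<circ> h1) y)"
    using h1 h2(2) by (auto simp: bij_betw_def)
  ultimately show ?thesis unfolding eq L_isomorphic_def by blast
qed

lemma L_isomorphic_sym:
  assumes "L_isomorphic (X, f) (Y, g)" and closed: "\<forall>x\<in>X. \<forall>y\<in>X. f x y \<in> X"
  shows "L_isomorphic (Y, g) (X, f)"
proof -
  obtain h where h: "bij_betw h X Y" "\<forall>x\<in>X. \<forall>y\<in>X. h (f x y) = g (h x) (h y)"
    using assms unfolding L_isomorphic_def by auto
  define i where "i = inv_into X h"
  have i: "bij_betw i Y X" unfolding i_def using h(1) by (rule bij_betw_inv_into)
  have "i (g x y) = f (i x) (i y)" if "x \<in> Y" "y \<in> Y" for x y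
  proof -
    have m: "i x \<in> X" "i y \<in> X" using i that by (auto simp: bij_betw_def)
    have "h (i x) = x" "h (i y) = y"
      using that h(1) unfolding i_def by (auto simp: bij_betw_inv_into_right)
    then have "g x y = h (f (i x) (i y))" using h(2) m by simp
    then show ?thesis
      using closed m h(1) unfolding i_def by (simp add: bij_betw_inv_into_left)
  qed
  with i show ?thesis unfolding L_isomorphic_def by auto
qed

lemma equiv_L_iso_rel: "equiv (linear_L_algebras n) (L_iso_rel n)"
proof (rule equivI)
  show "L_iso_rel n \<subseteq> linear_L_algebras n \<times> linear_L_algebras n"
    by (auto simp: L_iso_rel_def)
  show "refl_on (linear_L_algebras n) (L_iso_rel n)"
    by (auto simp: refl_on_def L_iso_rel_def L_isomorphic_refl)
  show "sym (L_iso_rel n)"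
    by (auto simp: sym_def L_iso_rel_def linear_L_algebras_def linear_L_algebra_def L_algebra_def
        intro!: L_isomorphic_sym)
  show "trans (L_iso_rel n)"
    by (auto simp: trans_def L_iso_rel_def intro: L_isomorphic_trans)
qed

lemma linear_L_algebra_nat_copy:
  fixes X :: "'a set"
  assumes lin: "linear_L_algebra X f" and fin: "finite X"
  shows "\<exists>A \<in> linear_L_algebras (card X). L_isomorphic (X, f) A"
proof -
  define Y where "Y = {0..<card X}"
  obtain h :: "'a \<Rightarrow> nat" where h: "bij_betw h X Y"
    using ex_bij_betw_finite_nat[OF fin] Y_def by blast
  define i where "i = inv_into X h"
  define g where "g u v = h (f (i u) (i v))" for u v
  have hX: "h ` X = Y" using h by (auto simp: bij_betw_def)
  have ih: "\<And>x. x \<in> X \<Longrightarrow> i (h x) = x"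
    unfolding i_def using h by (simp add: bij_betw_inv_into_left)
  have inj: "\<And>x y. x \<in> X \<Longrightarrow> y \<in> X \<Longrightarrow> h x = h y \<longleftrightarrow> x = y"
    using h by (auto simp: bij_betw_def inj_on_def)
  have gh: "\<And>x y. x \<in> X \<Longrightarrow> y \<in> X \<Longrightarrow> g (h x) (h y) = h (f x y)"
    by (simp add: g_def ih)
  have closed: "\<And>x y. x \<in> X \<Longrightarrow> y \<in> X \<Longrightarrow> f x y \<in> X"
    and cycloid: "\<And>x y z. x \<in> X \<Longrightarrow> y \<in> X \<Longrightarrow> z \<in> X \<Longrightarrow> f (f x y) (f x z) = f (f y x) (f y z)"
    using lin by (auto simp: linear_L_algebra_def L_algebra_def)
  obtain e where e: "logical_unit X f e"
    and anti: "\<And>x y. x \<in> X \<Longrightarrow> y \<in> X \<Longrightarrow> f x y = e \<Longrightarrow> f y x = e \<Longrightarrow> x = y"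
    using lin unfolding linear_L_algebra_def L_algebra_def by blast
  have eX: "e \<in> X" using e by (simp add: logical_unit_def)
  have tot: "\<And>x y. x \<in> X \<Longrightarrow> y \<in> X \<Longrightarrow> f x y = e \<or> f y x = e"
    using lin L_unit_eq[OF e] by (auto simp: linear_L_algebra_def L_le_def)
  have u: "logical_unit Y g (h e)"
    using e eX unfolding logical_unit_def hX[symmetric] by (simp add: gh)
  have "L_algebra Y g"
    unfolding L_algebra_def
  proof (intro conjI exI[of _ "h e"])
    show "\<forall>x\<in>Y. \<forall>y\<in>Y. g x y \<in> Y"
      unfolding hX[symmetric] by (auto simp: gh closed)
    show "\<forall>x\<in>Y. \<forall>y\<in>Y. \<forall>z\<in>Y. g (g x y) (g x z) = g (g y x) (g y z)"
      unfolding hX[symmetric] by (simp add: gh closed cycloid)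
    show "\<forall>x\<in>Y. \<forall>y\<in>Y. g x y = h e \<and> g y x = h e \<longrightarrow> x = y"
      unfolding hX[symmetric] by (auto simp: gh closed inj eX anti)
  qed (rule u)
  moreover have "\<forall>x\<in>Y. \<forall>y\<in>Y. L_le Y g x y \<or> L_le Y g y x"
    unfolding L_le_def L_unit_eq[OF u] unfolding hX[symmetric] using tot by (auto simp: gh closed inj eX)
  ultimately have "(Y, g) \<in> linear_L_algebras (card X)"
    by (simp add: linear_L_algebras_def linear_L_algebra_def Y_def)
  moreover have "L_isomorphic (X, f) (Y, g)"
    using h gh unfolding L_isomorphic_def by auto
  ultimately show ?thesis by blast
qed

end

theory Submission
  imports Defs "HOL-Library.Infinite_Set"
begin

text \<open>
  Number the elements of a linear \<open>L\<close>-algebra \<open>0, \<dots>, n - 1\<close> from the top. The rows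
  \<open>k \<mapsto> f i k\<close> are strictly increasing on \<open>{i..<n}\<close> with \<open>f i i = 0\<close>, and the defining equation
  becomes \<open>f (f i j) (f i k) = f j k\<close> for \<open>i \<le> j \<le> k\<close>. Chains are rigid, so isomorphism
  classes are such operations. Let \<open>g\<close> be the first row that moves the bottom element
  \<open>n - 1\<close>. Applying the equation to a row \<open>i < g\<close> and the bottom element shows that \<open>f i\<close> fixes \<open>g\<close>,
  hence everything from \<open>g\<close> on. The later rows are determined by row \<open>g\<close>, because
  \<open>f j k = f (f g j) (f g k)\<close> with \<open>f g j < j\<close>. Conversely, any operation on \<open>{..<g}\<close> and any strictly
  increasing row \<open>{g<..<n} \<rightarrow> {0<..<n - 1}\<close> can be combined in this way. Therefore
  \<open>\<lambda>(n) = (\<Sum>g=1..n - 1. (n - 2 choose g - 1) * \<lambda>(g))\<close> for \<open>n \<ge> 2\<close>, which is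
  the recurrence of the Bell numbers.
\<close>

section \<open>Bell numbers\<close>

lemma partition_on_bij_betw_image:
  assumes h: "bij_betw h A B" and P: "partition_on A P"
  shows "partition_on B ((`) h ` P)"
proof -
  have "(`) h ` P - {{}} = (`) h ` P"
    using partition_onD3[OF P] by auto
  then show ?thesis
    using partition_on_inj_image[OF P bij_betw_imp_inj_on[OF h]] bij_betw_imp_surj_on[OF h] by simp
qed

lemma partition_on_bij_betw_image_iff:
  assumes h: "bij_betw h A B" and P: "P \<subseteq> Pow A"
  shows "partition_on B ((`) h ` P) \<longleftrightarrow> partition_on A P"
proof
  have "inv_into A h ` h ` p = p" if "p \<in> P" for p
    using that P bij_betw_imp_inj_on[OF h] by (intro inv_into_image_cancel) auto
  then have "(`) (inv_into A h) ` (`) h ` P = P"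
    by (simp add: image_image)
  then show "partition_on A P" if "partition_on B ((`) h ` P)"
    using partition_on_bij_betw_image[OF bij_betw_inv_into[OF h] that] by simp
qed (rule partition_on_bij_betw_image[OF h])

lemma bij_betw_partitions:
  assumes "bij_betw h A B"
  shows "bij_betw ((`) ((`) h)) {P. partition_on A P} {P. partition_on B P}"
proof -
  have partitions: "{P. partition_on C P} = {P \<in> Pow (Pow C). partition_on C P}" for C :: "'c set"
    by (auto simp: partition_on_def)
  show ?thesis
    unfolding partitions using partition_on_bij_betw_image_iff[OF assms]
    by (intro bij_betw_Collect bij_betw_Pow assms) auto
qed

lemma card_partitions_eq_Bell:
  assumes "finite A"
  shows "card {P. partition_on A P} = Bell (card A)"
proof -
  obtain h where "bij_betw h A {..<card A}"
    using ex_bij_betw_finite_nat[OF assms] by (auto simp: atLeast0LessThan)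
  then show ?thesis
    unfolding Bell_def by (rule bij_betw_same_card[OF bij_betw_partitions])
qed

lemma partition_on_insert_block:
  assumes a: "a \<notin> A" and R: "R \<subseteq> A" and Q: "partition_on R Q"
  shows "partition_on (insert a A) (insert (insert a (A - R)) Q)"
proof -
  have "disjnt (insert a (A - R)) (\<Union>Q)"
    using a R partition_onD1[OF Q] by (auto simp: disjnt_def)
  moreover have "insert a A - insert a (A - R) = R"
    using a R by auto
  ultimately show ?thesis
    using Q by (auto simp: partition_on_insert)
qed

lemma partition_on_remove_block:
  assumes P: "partition_on A P" and p: "p \<in> P"
  shows "partition_on (A - p) (P - {p})"
proof -
  have "disjnt p (\<Union>(P - {p}))"
    using P p by (auto simp: partition_on_def disjnt_def pairwise_def)
  then show ?thesis
    using P p partition_on_insert[of p "P - {p}" A] by (simp add: insert_absorb)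
qed

lemma
  assumes a: "a \<notin> A" and P: "partition_on (insert a A) P"
  shows Union_avoiding_subset: "\<Union>{p \<in> P. a \<notin> p} \<subseteq> A"
    and partition_on_avoiding: "partition_on (\<Union>{p \<in> P. a \<notin> p}) {p \<in> P. a \<notin> p}"
    and insert_block_avoiding:
      "insert (insert a (A - \<Union>{p \<in> P. a \<notin> p})) {p \<in> P. a \<notin> p} = P"
proof -
  obtain p where p: "p \<in> P" "a \<in> p" "p \<subseteq> insert a A"
    using partition_onD1[OF P] by auto
  have avoiding: "{p \<in> P. a \<notin> p} = P - {p}"
    using P p by (auto simp: partition_on_def dest: disjointD)
  have remove: "partition_on (insert a A - p) {p \<in> P. a \<notin> p}"
    unfolding avoiding using P p(1) by (rule partition_on_remove_block)
  then have Union_avoiding: "\<Union>{p \<in> P. a \<notin> p} = insert a A - p"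
    by (rule partition_onD1[symmetric])
  show "\<Union>{p \<in> P. a \<notin> p} \<subseteq> A"
    unfolding Union_avoiding using p(2) by auto
  show "partition_on (\<Union>{p \<in> P. a \<notin> p}) {p \<in> P. a \<notin> p}"
    unfolding Union_avoiding by (rule remove)
  have "insert a (A - \<Union>{p \<in> P. a \<notin> p}) = p"
    unfolding Union_avoiding using p a by auto
  then show "insert (insert a (A - \<Union>{p \<in> P. a \<notin> p})) {p \<in> P. a \<notin> p} = P"
    using avoiding p(1) by (simp add: insert_absorb)
qed

lemma bij_betw_partitions_insert:
  assumes a: "a \<notin> A"
  shows "bij_betw (\<lambda>(R, Q). insert (insert a (A - R)) Q)
           (SIGMA R:Pow A. {Q. partition_on R Q}) {P. partition_on (insert a A) P}"
    (is "bij_betw ?F ?D ?E")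
proof (rule bij_betw_byWitness[where f' = "\<lambda>P. (\<Union>{p \<in> P. a \<notin> p}, {p \<in> P. a \<notin> p})"])
  show "\<forall>RQ\<in>?D. (\<Union>{p \<in> ?F RQ. a \<notin> p}, {p \<in> ?F RQ. a \<notin> p}) = RQ"
  proof
    fix RQ assume "RQ \<in> ?D"
    then obtain R Q where RQ: "RQ = (R, Q)" "R \<subseteq> A" and Q: "partition_on R Q"
      by auto
    then have "{p \<in> ?F RQ. a \<notin> p} = Q"
      using a partition_onD1[OF Q] by auto
    then show "(\<Union>{p \<in> ?F RQ. a \<notin> p}, {p \<in> ?F RQ. a \<notin> p}) = RQ"
      using RQ(1) partition_onD1[OF Q] by simp
  qed
  show "\<forall>P\<in>?E. ?F (\<Union>{p \<in> P. a \<notin> p}, {p \<in> P. a \<notin> p}) = P"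
    using insert_block_avoiding[OF a] by simp
  show "?F ` ?D \<subseteq> ?E"
    using partition_on_insert_block[OF a] by auto
  show "(\<lambda>P. (\<Union>{p \<in> P. a \<notin> p}, {p \<in> P. a \<notin> p})) ` ?E \<subseteq> ?D"
    using Union_avoiding_subset[OF a] partition_on_avoiding[OF a] by auto
qed

lemma sum_Pow_card:
  fixes F :: "nat \<Rightarrow> 'b::semiring_1"
  assumes "finite S"
  shows "(\<Sum>A\<in>Pow S. F (card A)) = (\<Sum>k\<le>card S. of_nat (card S choose k) * F k)"
proof -
  have "(\<Sum>A\<in>Pow S. F (card A)) = (\<Sum>k\<le>card S. \<Sum>A | A \<in> Pow S \<and> card A = k. F (card A))"
    using assms by (intro sum.group[symmetric]) (auto intro: card_mono)
  also have "\<dots> = (\<Sum>k\<le>card S. of_nat (card {A. A \<subseteq> S \<and> card A = k}) * F k)"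
    by (rule sum.cong) auto
  finally show ?thesis
    using assms by (simp add: n_subsets)
qed

lemma Bell_Suc: "Bell (Suc m) = (\<Sum>k\<le>m. (m choose k) * Bell k)"
proof -
  have "Bell (Suc m) = card (SIGMA R:Pow {..<m}. {Q. partition_on R Q})"
    unfolding Bell_def lessThan_Suc
    by (rule bij_betw_same_card[OF bij_betw_partitions_insert, symmetric]) simp
  also have "\<dots> = (\<Sum>R\<in>Pow {..<m}. card {Q. partition_on R Q})"
    by (intro card_SigmaI) (auto intro: finitely_many_partition_on finite_subset)
  also have "\<dots> = (\<Sum>R\<in>Pow {..<m}. Bell (card R))"
    by (intro sum.cong) (auto intro: card_partitions_eq_Bell finite_subset)
  finally show ?thesis
    by (simp add: sum_Pow_card)
qed

section \<open>Strictly increasing maps\<close>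

lemma strict_mono_on_add_diff_le:
  fixes \<psi> :: "nat \<Rightarrow> nat"
  assumes mono: "strict_mono_on {k..l} \<psi>" and "k \<le> l"
  shows "\<psi> k + (l - k) \<le> \<psi> l"
proof -
  have "\<psi> ` {k..l} \<subseteq> {\<psi> k..\<psi> l}"
    using mono by (auto simp: strict_mono_on_leD)
  then have "card {k..l} \<le> card {\<psi> k..\<psi> l}"
    using card_image[OF strict_mono_on_imp_inj_on[OF mono]] card_mono by (metis finite_atLeastAtMost)
  then show ?thesis
    using \<open>k \<le> l\<close> by simp
qed

lemma strict_mono_on_eq_if_image_eq:
  fixes f g :: "'a::linorder \<Rightarrow> 'b::linorder"
  assumes "finite A" "strict_mono_on A f" "strict_mono_on A g" "f ` A = g ` A" "x \<in> A"
  shows "f x = g x"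
proof -
  have "sorted_wrt (<) (map h (sorted_list_of_set A))" if "strict_mono_on A h" for h :: "'a \<Rightarrow> 'b"
    unfolding sorted_wrt_map
  proof (rule sorted_wrt_mono_rel)
    show "sorted_wrt (<) (sorted_list_of_set A)"
      by (simp add: strict_sorted_iff)
  qed (use that \<open>finite A\<close> in \<open>simp add: strict_mono_onD\<close>)
  then have "map f (sorted_list_of_set A) = map g (sorted_list_of_set A)"
    using assms by (intro strict_sorted_equal) auto
  then show ?thesis
    using \<open>finite A\<close> \<open>x \<in> A\<close> by simp
qed

lemma ex_strict_mono_on_image_eq:
  fixes I :: "'a::wellorder set" and A :: "'b::wellorder set"
  assumes "finite I" "finite A" "card I = card A"
  shows "\<exists>\<psi>. strict_mono_on I \<psi> \<and> \<psi> ` I = A"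
proof -
  obtain u where u: "bij_betw u {..<card I} I" "strict_mono_on {..<card I} u"
    using \<open>finite I\<close> by (rule ex_bij_betw_strict_mono_card)
  obtain v where v: "bij_betw v {..<card I} A" "strict_mono_on {..<card I} v"
    using ex_bij_betw_strict_mono_card[OF \<open>finite A\<close>] assms(3) by metis
  define w where "w = inv_into {..<card I} u"
  have w: "bij_betw w I {..<card I}"
    unfolding w_def using u(1) by (rule bij_betw_inv_into)
  have "strict_mono_on I w"
  proof (rule strict_mono_onI)
    fix x y assume "x \<in> I" "y \<in> I" "x < y"
    moreover from this have "w x \<in> {..<card I}" "w y \<in> {..<card I}"
      using bij_betw_apply[OF w] by blast+
    ultimately have "u (w x) < u (w y)" "w x \<in> {..<card I}" "w y \<in> {..<card I}"
      using u(1) by (simp_all add: w_def bij_betw_inv_into_right)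
    then show "w x < w y"
      using strict_mono_on_less[OF u(2)] by blast
  qed
  then have "strict_mono_on I (v \<circ> w)"
    using v(2) bij_betw_apply[OF w] by (auto simp: strict_mono_on_def)
  moreover have "(v \<circ> w) ` I = A"
    using bij_betw_trans[OF w v(1)] by (rule bij_betw_imp_surj_on)
  ultimately show ?thesis by blast
qed

definition increasing_maps :: "'a::linorder set \<Rightarrow> 'b::{linorder,zero} set \<Rightarrow> ('a \<Rightarrow> 'b) set" where
  "increasing_maps I J = {\<psi>. strict_mono_on I \<psi> \<and> \<psi> ` I \<subseteq> J \<and> (\<forall>x. x \<notin> I \<longrightarrow> \<psi> x = 0)}"

lemma finite_increasing_maps:
  assumes "finite I" "finite J"
  shows "finite (increasing_maps I J)"
  by (rule finite_subset[OF _ finite_set_of_finite_funs[OF assms, of 0]])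
    (auto simp: increasing_maps_def)

lemma bij_betw_image_increasing_maps:
  fixes I :: "'a::wellorder set" and J :: "'b::{wellorder,zero} set"
  assumes "finite I" "finite J"
  shows "bij_betw (\<lambda>\<psi>. \<psi> ` I) (increasing_maps I J) {A. A \<subseteq> J \<and> card A = card I}"
proof (rule bij_betw_imageI)
  show "inj_on (\<lambda>\<psi>. \<psi> ` I) (increasing_maps I J)"
  proof (intro inj_onI ext)
    fix \<psi> \<phi> x assume "\<psi> \<in> increasing_maps I J" "\<phi> \<in> increasing_maps I J" "\<psi> ` I = \<phi> ` I"
    then show "\<psi> x = \<phi> x"
      using strict_mono_on_eq_if_image_eq[OF \<open>finite I\<close>, of \<psi> \<phi> x]
      by (cases "x \<in> I") (auto simp: increasing_maps_def)
  qed
  show "(\<lambda>\<psi>. \<psi> ` I) ` increasing_maps I J = {A. A \<subseteq> J \<and> card A = card I}"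
  proof (intro equalityI subsetI)
    fix A assume "A \<in> (\<lambda>\<psi>. \<psi> ` I) ` increasing_maps I J"
    then show "A \<in> {A. A \<subseteq> J \<and> card A = card I}"
      by (auto simp: increasing_maps_def card_image strict_mono_on_imp_inj_on)
  next
    fix A assume A: "A \<in> {A. A \<subseteq> J \<and> card A = card I}"
    then obtain \<psi> where \<psi>: "strict_mono_on I \<psi>" "\<psi> ` I = A"
      using ex_strict_mono_on_image_eq[OF \<open>finite I\<close>, of A] finite_subset[OF _ \<open>finite J\<close>] by auto
    let ?\<phi> = "\<lambda>x. if x \<in> I then \<psi> x else 0"
    have "?\<phi> \<in> increasing_maps I J" "?\<phi> ` I = A"
      using A \<psi> by (auto simp: increasing_maps_def strict_mono_on_def)
    then show "A \<in> (\<lambda>\<psi>. \<psi> ` I) ` increasing_maps I J" by blast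
  qed
qed

lemma card_increasing_maps:
  fixes I :: "'a::wellorder set" and J :: "'b::{wellorder,zero} set"
  assumes "finite I" "finite J"
  shows "card (increasing_maps I J) = card J choose card I"
  using bij_betw_same_card[OF bij_betw_image_increasing_maps[OF assms]] n_subsets[OF \<open>finite J\<close>]
  by simp

section \<open>Enumerations and transversals\<close>

lemma ex_linear_order_enumeration:
  assumes "finite X" and r: "linear_order_on X r"
  obtains s where "bij_betw s {..<card X} X"
    and "\<And>i j. i < card X \<Longrightarrow> j < card X \<Longrightarrow> (s i, s j) \<in> r \<longleftrightarrow> i \<le> j"
proof
  define rank where "rank x = card (underS r x)" for x
  have "r \<subseteq> X \<times> X" and refl: "refl_on X r" and trans: "trans r" and antisym: "antisym r"
    and total: "total_on X r"
    using r by (simp_all add: order_on_defs)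
  have under: "underS r x \<subseteq> X" for x
    using \<open>r \<subseteq> X \<times> X\<close> by (auto simp: underS_def)
  have rank_less: "rank x < rank y" if "(x, y) \<in> r" "x \<noteq> y" for x y
  proof -
    have "underS r x \<subset> underS r y"
      using that trans antisym by (auto simp: underS_def dest: transD antisymD)
    then show ?thesis
      unfolding rank_def using finite_subset[OF under \<open>finite X\<close>] by (intro psubset_card_mono)
  qed
  have rank_le_iff: "rank x \<le> rank y \<longleftrightarrow> (x, y) \<in> r" if "x \<in> X" "y \<in> X" for x y
    using rank_less[of x y] rank_less[of y x] that refl total
    unfolding refl_on_def total_on_def by (metis less_imp_le_nat linorder_not_le)
  have inj: "inj_on rank X"
    by (intro inj_onI antisymD[OF antisym]) (simp_all flip: rank_le_iff)
  have "rank x < card X" if "x \<in> X" for x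
    unfolding rank_def using that under \<open>finite X\<close>
    by (intro psubset_card_mono) (auto simp: underS_def)
  then have "rank ` X = {..<card X}"
    by (intro card_subset_eq) (auto simp: card_image[OF inj])
  with inj have bij: "bij_betw rank X {..<card X}"
    by (simp add: bij_betw_def)
  then show s: "bij_betw (inv_into X rank) {..<card X} X"
    by (rule bij_betw_inv_into)
  show "(inv_into X rank i, inv_into X rank j) \<in> r \<longleftrightarrow> i \<le> j" if "i < card X" "j < card X" for i j
    using rank_le_iff[of "inv_into X rank i" "inv_into X rank j"] that bij_betw_apply[OF s]
    by (simp add: bij_betw_inv_into_right[OF bij])
qed

lemma card_quotient_eq_card_transversal:
  assumes r: "equiv A r" and "T \<subseteq> A"
    and inequivalent: "\<And>x y. x \<in> T \<Longrightarrow> y \<in> T \<Longrightarrow> (x, y) \<in> r \<Longrightarrow> x = y"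
    and representative: "\<And>x. x \<in> A \<Longrightarrow> \<exists>y\<in>T. (y, x) \<in> r"
  shows "card (A // r) = card T"
proof -
  have "bij_betw (\<lambda>x. r `` {x}) T (A // r)"
  proof (rule bij_betw_imageI)
    show "inj_on (\<lambda>x. r `` {x}) T"
      using \<open>T \<subseteq> A\<close> inequivalent eq_equiv_class[OF _ r] by (intro inj_onI) blast
    show "(\<lambda>x. r `` {x}) ` T = A // r"
    proof
      show "(\<lambda>x. r `` {x}) ` T \<subseteq> A // r"
        using \<open>T \<subseteq> A\<close> by (auto intro: quotientI)
      show "A // r \<subseteq> (\<lambda>x. r `` {x}) ` T"
      proof
        fix C assume "C \<in> A // r"
        then obtain x where "x \<in> A" "C = r `` {x}"
          by (rule quotientE)
        moreover from this obtain y where "y \<in> T" "(y, x) \<in> r"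
          using representative by blast
        ultimately show "C \<in> (\<lambda>x. r `` {x}) ` T"
          using equiv_class_eq[OF r] by blast
      qed
    qed
  qed
  then show ?thesis
    by (rule bij_betw_same_card[symmetric])
qed

section \<open>The natural order of an \<open>L\<close>-algebra\<close>

lemma
  assumes "L_algebra X f"
  shows L_algebra_closed: "x \<in> X \<Longrightarrow> y \<in> X \<Longrightarrow> f x y \<in> X"
    and L_algebra_cycloid:
      "x \<in> X \<Longrightarrow> y \<in> X \<Longrightarrow> z \<in> X \<Longrightarrow> f (f x y) (f x z) = f (f y x) (f y z)"
    and L_algebra_unit: "logical_unit X f (L_unit X f)"
    and L_le_antisym: "x \<in> X \<Longrightarrow> y \<in> X \<Longrightarrow> L_le X f x y \<Longrightarrow> L_le X f y x \<Longrightarrow> x = y"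
proof -
  obtain e where "logical_unit X f e" "\<forall>x\<in>X. \<forall>y\<in>X. f x y = e \<and> f y x = e \<longrightarrow> x = y"
    using assms unfolding L_algebra_def by blast
  then show "logical_unit X f (L_unit X f)"
    and "x \<in> X \<Longrightarrow> y \<in> X \<Longrightarrow> L_le X f x y \<Longrightarrow> L_le X f y x \<Longrightarrow> x = y"
    by (simp_all add: L_unit_eq L_le_def)
qed (use assms in \<open>simp_all add: L_algebra_def\<close>)

lemma
  assumes "L_algebra X f"
  shows L_unit_mem: "L_unit X f \<in> X"
    and L_unit_left: "x \<in> X \<Longrightarrow> f (L_unit X f) x = x"
    and L_unit_right: "x \<in> X \<Longrightarrow> f x (L_unit X f) = L_unit X f"
    and L_le_refl: "x \<in> X \<Longrightarrow> L_le X f x x"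
  using L_algebra_unit[OF assms] by (simp_all add: logical_unit_def L_le_def)

lemma L_algebra_cycloid_if_L_le:
  assumes "L_algebra X f" "x \<in> X" "y \<in> X" "z \<in> X" "L_le X f x y"
  shows "f (f y x) (f y z) = f x z"
proof -
  have "f (f y x) (f y z) = f (f x y) (f x z)"
    using assms by (intro L_algebra_cycloid)
  also have "\<dots> = f (L_unit X f) (f x z)"
    using assms by (simp add: L_le_def)
  also have "\<dots> = f x z"
    using assms by (simp add: L_unit_left L_algebra_closed)
  finally show ?thesis .
qed

lemma L_le_trans:
  assumes "L_algebra X f" "x \<in> X" "y \<in> X" "z \<in> X" "L_le X f x y" "L_le X f y z"
  shows "L_le X f x z"
  using L_algebra_cycloid_if_L_le[of X f x y z] assms
  by (simp add: L_le_def L_unit_right L_algebra_closed)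

lemma partial_order_on_L_le:
  assumes "L_algebra X f"
  shows "partial_order_on X {(x, y). x \<in> X \<and> y \<in> X \<and> L_le X f x y}"
  unfolding partial_order_on_def preorder_on_def
proof (intro conjI)
  show "refl_on X {(x, y). x \<in> X \<and> y \<in> X \<and> L_le X f x y}"
    using L_le_refl[OF assms] by (simp add: refl_on_def)
  show "trans {(x, y). x \<in> X \<and> y \<in> X \<and> L_le X f x y}"
    using L_le_trans[OF assms] unfolding trans_def by blast
  show "antisym {(x, y). x \<in> X \<and> y \<in> X \<and> L_le X f x y}"
    using L_le_antisym[OF assms] unfolding antisym_def by blast
qed auto

lemma linear_order_on_L_le:
  assumes "linear_L_algebra X f"
  shows "linear_order_on X {(x, y). x \<in> X \<and> y \<in> X \<and> L_le X f x y}"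
  using assms partial_order_on_L_le
  by (auto simp: linear_L_algebra_def linear_order_on_def total_on_def)

section \<open>Operations on an initial segment of the natural numbers\<close>

text \<open>
  The elements of a linear \<open>L\<close>-algebra are numbered from the top, so that \<open>0\<close> is the unit and the
  natural order is the reverse of the order of the numbers. The value \<open>0\<close> outside the carrier makes
  each operation determined by its restriction to the carrier.
\<close>

locale L_chain =
  fixes n :: nat and f :: "nat \<Rightarrow> nat \<Rightarrow> nat"
  assumes unit_left: "k < n \<Longrightarrow> f 0 k = k"
    and eq_0_iff: "f i k = 0 \<longleftrightarrow> k \<le> i \<or> n \<le> k"
    and closed: "k < n \<Longrightarrow> f i k < n"
    and cycloid: "i \<le> j \<Longrightarrow> j \<le> k \<Longrightarrow> k < n \<Longrightarrow> f (f i j) (f i k) = f j k"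

lemma finite_L_chains: "finite {f. L_chain n f}"
proof -
  define rows where "rows = {r. \<forall>k. (k \<in> {..<n} \<longrightarrow> r k \<in> {..<n}) \<and> (k \<notin> {..<n} \<longrightarrow> r k = 0)}"
  define ops where "ops = {f. \<forall>i. (i \<in> {..<n} \<longrightarrow> f i \<in> rows) \<and> (i \<notin> {..<n} \<longrightarrow> f i = (\<lambda>k. 0))}"
  have "finite rows"
    unfolding rows_def by (intro finite_set_of_finite_funs) auto
  then have "finite ops"
    unfolding ops_def by (intro finite_set_of_finite_funs) auto
  moreover have "{f. L_chain n f} \<subseteq> ops"
    by (auto simp: ops_def rows_def L_chain.closed L_chain.eq_0_iff fun_eq_iff)
  ultimately show ?thesis
    by (rule finite_subset[rotated])
qed

context L_chain
begin

lemma row_strict_mono: "strict_mono_on {i..<n} (f i)"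
proof (rule strict_mono_onI)
  fix k l assume "k \<in> {i..<n}" "l \<in> {i..<n}" "k < l"
  then have "f (f i k) (f i l) \<noteq> 0"
    using cycloid[of i k l] eq_0_iff[of k l] by simp
  then show "f i k < f i l"
    using eq_0_iff[of "f i k" "f i l"] by simp
qed

lemma row_add_diff_le:
  assumes "i \<le> k" "k \<le> l" "l < n"
  shows "f i k + (l - k) \<le> f i l"
  using assms by (intro strict_mono_on_add_diff_le monotone_on_subset[OF row_strict_mono]) auto

lemma row_mono:
  assumes "k \<le> l" "l < n"
  shows "f i k \<le> f i l"
proof (cases "i \<le> k")
  case True
  then show ?thesis
    using row_add_diff_le[of i k l] assms by simp
next
  case False
  then have "f i k = 0"
    by (simp add: eq_0_iff)
  then show ?thesis by simp
qed

lemma row_le: "f i k \<le> k"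
proof (cases "k \<le> i \<or> n \<le> k")
  case True
  then have "f i k = 0"
    by (simp add: eq_0_iff)
  then show ?thesis by simp
next
  case False
  then have "f i k + (n - 1 - k) \<le> f i (n - 1)" "f i (n - 1) < n"
    using row_add_diff_le[of i k "n - 1"] closed[of "n - 1" i] by linarith+
  then show ?thesis
    using False by linarith
qed

end

definition restrict_op :: "nat \<Rightarrow> (nat \<Rightarrow> nat \<Rightarrow> nat) \<Rightarrow> nat \<Rightarrow> nat \<Rightarrow> nat" where
  "restrict_op g f j k = (if k < g then f j k else 0)"

lemma (in L_chain) L_chain_restrict_op:
  assumes "g \<le> n"
  shows "L_chain g (restrict_op g f)"
proof
  show "restrict_op g f i k < g" if "k < g" for i k
    using that row_le[of i k] by (simp add: restrict_op_def)
  show "restrict_op g f (restrict_op g f i j) (restrict_op g f i k) = restrict_op g f j k"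
    if "i \<le> j" "j \<le> k" "k < g" for i j k
    using that assms cycloid[of i j k] row_le[of i k] by (simp add: restrict_op_def)
qed (use assms in \<open>auto simp: restrict_op_def unit_left eq_0_iff\<close>)

text \<open>
  The operation on \<open>{..<n}\<close> with restriction \<open>h\<close> to \<open>{..<g}\<close> and row \<open>\<psi>\<close> at \<open>g\<close>. The test
  \<open>\<psi> j < j\<close> only serves termination; it holds on \<open>{g..<n}\<close> for every
  \<open>\<psi> \<in> increasing_maps {g<..<n} {0<..<n - 1}\<close>.
\<close>

function glue :: "nat \<Rightarrow> nat \<Rightarrow> (nat \<Rightarrow> nat \<Rightarrow> nat) \<Rightarrow> (nat \<Rightarrow> nat) \<Rightarrow> nat \<Rightarrow> nat \<Rightarrow> nat" where
  "glue n g h \<psi> j k =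
     (if k < g then h j k
      else if n \<le> k \<or> k \<le> j then 0
      else if j < g then k
      else if \<psi> j < j then glue n g h \<psi> (\<psi> j) (\<psi> k)
      else 0)"
  by auto
termination by (relation "measure (\<lambda>(n, g, h, \<psi>, j, k). j)") auto

declare glue.simps [simp del]

locale L_chain_glue = top: L_chain g h for g h +
  fixes n :: nat and \<psi> :: "nat \<Rightarrow> nat"
  assumes g_pos: "0 < g" and g_less: "g < n"
    and row: "\<psi> \<in> increasing_maps {g<..<n} {0<..<n - 1}"
begin

abbreviation glued :: "nat \<Rightarrow> nat \<Rightarrow> nat" where
  "glued \<equiv> glue n g h \<psi>"

lemma row_outside: "k \<le> g \<or> n \<le> k \<Longrightarrow> \<psi> k = 0"
  using row by (auto simp: increasing_maps_def)

lemma row_bounds: "g < k \<Longrightarrow> k < n \<Longrightarrow> 0 < \<psi> k \<and> \<psi> k < n - 1"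
  using row by (simp add: increasing_maps_def image_subset_iff)

lemma row_strict_mono: "strict_mono_on {g..<n} \<psi>"
proof (rule strict_mono_onI)
  fix k l assume "k \<in> {g..<n}" "l \<in> {g..<n}" "k < l"
  then show "\<psi> k < \<psi> l"
    using row row_outside[of g] row_bounds[of l]
    by (cases "k = g") (auto simp: increasing_maps_def strict_mono_on_def)
qed

lemma row_le_iff: "g \<le> k \<Longrightarrow> k < n \<Longrightarrow> g \<le> l \<Longrightarrow> l < n \<Longrightarrow> \<psi> k \<le> \<psi> l \<longleftrightarrow> k \<le> l"
  using strict_mono_on_less_eq[OF row_strict_mono] by simp

lemma row_less:
  assumes "g \<le> k" "k < n"
  shows "\<psi> k < k"
proof (cases "k = g")
  case True
  then show ?thesis
    using row_outside[of g] g_pos by simp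
next
  case False
  have "\<psi> k + (n - 1 - k) \<le> \<psi> (n - 1)"
    using assms by (intro strict_mono_on_add_diff_le monotone_on_subset[OF row_strict_mono]) auto
  moreover have "\<psi> (n - 1) < n - 1"
    using row_bounds[of "n - 1"] assms False by simp
  ultimately show ?thesis
    using assms by linarith
qed

lemma row_less_n: "g \<le> k \<Longrightarrow> k < n \<Longrightarrow> \<psi> k < n"
  using row_less[of k] by simp

lemma glue_top: "k < g \<Longrightarrow> glued j k = h j k"
  by (subst glue.simps) simp

lemma glue_fixes: "j < g \<Longrightarrow> g \<le> k \<Longrightarrow> k < n \<Longrightarrow> glued j k = k"
  by (subst glue.simps) simp

lemma glue_eq_0: "k \<le> j \<or> n \<le> k \<Longrightarrow> glued j k = 0"
  using g_less top.eq_0_iff by (subst glue.simps) auto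

lemma glue_unit_left: "k < n \<Longrightarrow> glued 0 k = k"
  using g_pos top.unit_left glue_top glue_fixes by (cases "k < g") auto

lemma glue_rec:
  assumes "g \<le> j" "j \<le> k" "k < n"
  shows "glued j k = glued (\<psi> j) (\<psi> k)"
proof (cases "j = k")
  case True
  then show ?thesis by (simp add: glue_eq_0)
next
  case False
  then show ?thesis
    using assms row_less[of j] by (subst glue.simps) auto
qed

lemma glue_row: "glued g = \<psi>"
proof
  fix k
  show "glued g k = \<psi> k"
  proof (cases "g \<le> k \<and> k < n")
    case True
    then show ?thesis
      using glue_rec[of g k] row_outside[of g] glue_unit_left[OF row_less_n, of k] by simp
  next
    case False
    then show ?thesis
      using glue_eq_0[of k g] row_outside[of k] by auto
  qed
qed

lemma glue_less: "k < n \<Longrightarrow> glued j k < n"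
proof (induction j arbitrary: k rule: less_induct)
  case (less j)
  consider (top) "k < g" | (zero) "g \<le> k" "k \<le> j" | (fixed) "g \<le> k" "j < g"
    | (rec) "g \<le> j" "j < k"
    by linarith
  then show ?case
  proof cases
    case top
    then show ?thesis
      using top.closed[of k j] g_less by (simp add: glue_top)
  next
    case rec
    then show ?thesis
      using less row_less[of j] row_less_n[of k] by (simp add: glue_rec)
  qed (use less.prems in \<open>simp_all add: glue_eq_0 glue_fixes\<close>)
qed

lemma glue_pos: "j < k \<Longrightarrow> k < n \<Longrightarrow> 0 < glued j k"
proof (induction j arbitrary: k rule: less_induct)
  case (less j)
  consider (top) "k < g" | (fixed) "j < g" "g \<le> k" | (rec) "g \<le> j"
    by linarith
  then show ?case
  proof cases
    case top
    then show ?thesis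
      using top.eq_0_iff[of j k] less.prems by (simp add: glue_top)
  next
    case rec
    then have "\<psi> j < \<psi> k"
      using row_le_iff[of k j] less.prems by simp
    then show ?thesis
      using rec less row_less[of j] row_less_n[of k] by (simp add: glue_rec)
  qed (use less.prems in \<open>simp add: glue_fixes\<close>)
qed

lemma glue_cycloid: "i \<le> j \<Longrightarrow> j \<le> k \<Longrightarrow> k < n \<Longrightarrow> glued (glued i j) (glued i k) = glued j k"
proof (induction i arbitrary: j k rule: less_induct)
  case (less i)
  consider (top) "k < g" | (fixed_right) "j < g" "g \<le> k" | (fixed) "i < g" "g \<le> j"
    | (rec) "g \<le> i"
    by linarith
  then show ?case
  proof cases
    case top
    then show ?thesis
      using less.prems top.cycloid top.closed by (simp add: glue_top)
  next
    case fixed_right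
    then show ?thesis
      using less.prems top.closed by (simp add: glue_top glue_fixes)
  next
    case fixed
    then show ?thesis
      using less.prems by (simp add: glue_fixes)
  next
    case rec
    then have "glued (glued (\<psi> i) (\<psi> j)) (glued (\<psi> i) (\<psi> k)) = glued (\<psi> j) (\<psi> k)"
      using less.prems by (intro less.IH) (auto simp: row_less row_le_iff row_less_n)
    then show ?thesis
      using rec less.prems by (simp add: glue_rec)
  qed
qed

lemma L_chain_glue: "L_chain n glued"
proof
  show "glued j k = 0 \<longleftrightarrow> k \<le> j \<or> n \<le> k" for j k
    using glue_eq_0[of k j] glue_pos[of j k] by force
qed (fact glue_unit_left glue_less glue_cycloid)+

lemma restrict_op_glue: "restrict_op g glued = h"
  using top.eq_0_iff by (auto simp: fun_eq_iff restrict_op_def glue_top)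

end

section \<open>Splitting an operation at the first row that moves the bottom\<close>

definition pivot :: "nat \<Rightarrow> (nat \<Rightarrow> nat \<Rightarrow> nat) \<Rightarrow> nat" where
  "pivot n f = (LEAST i. f i (n - 1) < n - 1)"

lemma (in L_chain_glue) pivot_glue: "pivot n glued = g"
  unfolding pivot_def
proof (rule Least_equality)
  show "glued g (n - 1) < n - 1"
    using row_less[of "n - 1"] g_less by (simp add: glue_row)
  show "g \<le> i" if "glued i (n - 1) < n - 1" for i
    using glue_fixes[of i "n - 1"] g_less that by (cases "g \<le> i") auto
qed

context L_chain
begin

context
  assumes two_le: "2 \<le> n"
begin

lemma last_row_moves_bottom: "f (n - 1) (n - 1) < n - 1"
  using two_le eq_0_iff[of "n - 1" "n - 1"] by simp

lemma pivot_moves_bottom: "f (pivot n f) (n - 1) < n - 1"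
  unfolding pivot_def using last_row_moves_bottom by (rule LeastI)

lemma pivot_le: "f i (n - 1) < n - 1 \<Longrightarrow> pivot n f \<le> i"
  unfolding pivot_def by (rule Least_le)

lemma pivot_less: "pivot n f < n"
  using pivot_le[OF last_row_moves_bottom] two_le by simp

lemma pivot_pos: "0 < pivot n f"
  using pivot_moves_bottom unit_left[of "n - 1"] two_le by (cases "pivot n f = 0") auto

lemma fixes_bottom_before_pivot: "j < pivot n f \<Longrightarrow> f j (n - 1) = n - 1"
  using pivot_le[of j] row_le[of j "n - 1"] by force

lemma fixes_pivot_before_pivot:
  assumes "j < pivot n f"
  shows "f j (pivot n f) = pivot n f"
proof -
  have "f (f j (pivot n f)) (n - 1) = f (pivot n f) (n - 1)"
    using cycloid[of j "pivot n f" "n - 1"] assms pivot_less fixes_bottom_before_pivot by simp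
  then have "pivot n f \<le> f j (pivot n f)"
    using pivot_moves_bottom by (intro pivot_le) simp
  then show ?thesis
    using row_le[of j "pivot n f"] by simp
qed

lemma fixes_from_pivot_before_pivot:
  assumes "j < pivot n f" "pivot n f \<le> k" "k < n"
  shows "f j k = k"
  using row_add_diff_le[of j "pivot n f" k] fixes_pivot_before_pivot[of j] row_le[of j k] assms by simp

lemma pivot_row_increasing: "f (pivot n f) \<in> increasing_maps {pivot n f<..<n} {0<..<n - 1}"
proof -
  have "strict_mono_on {pivot n f<..<n} (f (pivot n f))"
    by (rule monotone_on_subset[OF row_strict_mono[of "pivot n f"]]) auto
  moreover have "f (pivot n f) k < n - 1" if "k < n" for k
    using row_mono[of k "n - 1" "pivot n f"] pivot_moves_bottom that by linarith
  moreover have "0 < f (pivot n f) k" if "pivot n f < k" "k < n" for k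
    using eq_0_iff[of "pivot n f" k] that by simp
  ultimately show ?thesis
    using eq_0_iff by (auto simp: increasing_maps_def)
qed

lemma L_chain_glue_pivot:
  "L_chain_glue (pivot n f) (restrict_op (pivot n f) f) n (f (pivot n f))"
  using L_chain_restrict_op pivot_less pivot_pos pivot_row_increasing
  by (simp add: L_chain_glue_def L_chain_glue_axioms_def)

lemma glue_pivot: "glue n (pivot n f) (restrict_op (pivot n f) f) (f (pivot n f)) = f"
proof -
  interpret split: L_chain_glue "pivot n f" "restrict_op (pivot n f) f" n "f (pivot n f)"
    by (rule L_chain_glue_pivot)
  have "split.glued j k = f j k" for j k
  proof (induction j arbitrary: k rule: less_induct)
    case (less j)
    consider (top) "k < pivot n f" | (zero) "k \<le> j \<or> n \<le> k"
      | (fixed) "pivot n f \<le> k" "k < n" "j < pivot n f"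
      | (rec) "pivot n f \<le> j" "j < k" "k < n"
      by linarith
    then show ?case
    proof cases
      case top
      then show ?thesis
        by (subst split.glue_top) (simp_all add: restrict_op_def)
    next
      case zero
      then show ?thesis
        using eq_0_iff[of j k] by (simp add: split.glue_eq_0)
    next
      case fixed
      then show ?thesis
        by (simp add: split.glue_fixes fixes_from_pivot_before_pivot)
    next
      case rec
      then have "split.glued j k = f (f (pivot n f) j) (f (pivot n f) k)"
        using split.row_less[of j] by (simp add: split.glue_rec less.IH)
      also have "\<dots> = f j k"
        using rec by (intro cycloid) auto
      finally show ?thesis .
    qed
  qed
  then show ?thesis by blast
qed

end

end

definition split_at_pivot ::
    "nat \<Rightarrow> (nat \<Rightarrow> nat \<Rightarrow> nat) \<Rightarrow> nat \<times> (nat \<Rightarrow> nat \<Rightarrow> nat) \<times> (nat \<Rightarrow> nat)" where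
  "split_at_pivot n f = (pivot n f, restrict_op (pivot n f) f, f (pivot n f))"

lemma bij_betw_glue:
  assumes "2 \<le> n"
  shows "bij_betw (\<lambda>(g, h, \<psi>). glue n g h \<psi>)
           (SIGMA g:{0<..<n}. {h. L_chain g h} \<times> increasing_maps {g<..<n} {0<..<n - 1})
           {f. L_chain n f}"
    (is "bij_betw ?glue ?D _")
proof (rule bij_betw_byWitness[where f' = "split_at_pivot n"])
  have D_iff: "(g, h, \<psi>) \<in> ?D \<longleftrightarrow> L_chain_glue g h n \<psi>" for g h \<psi>
    by (auto simp: L_chain_glue_def L_chain_glue_axioms_def)
  have "split_at_pivot n (glue n g h \<psi>) = (g, h, \<psi>)" if "(g, h, \<psi>) \<in> ?D" for g h \<psi>
    using that unfolding D_iff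
    by (simp add: split_at_pivot_def L_chain_glue.pivot_glue L_chain_glue.restrict_op_glue
        L_chain_glue.glue_row)
  then show "\<forall>d\<in>?D. split_at_pivot n (?glue d) = d"
    by auto
  show "\<forall>f\<in>{f. L_chain n f}. ?glue (split_at_pivot n f) = f"
    using assms by (simp add: split_at_pivot_def L_chain.glue_pivot)
  have "L_chain n (glue n g h \<psi>)" if "(g, h, \<psi>) \<in> ?D" for g h \<psi>
    using that unfolding D_iff by (rule L_chain_glue.L_chain_glue)
  then show "?glue ` ?D \<subseteq> {f. L_chain n f}"
    by auto
  show "split_at_pivot n ` {f. L_chain n f} \<subseteq> ?D"
    unfolding split_at_pivot_def using D_iff L_chain.L_chain_glue_pivot[OF _ assms] by blast
qed

lemma card_L_chains_Suc_Suc: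
  "card {f. L_chain (Suc (Suc m)) f} = (\<Sum>k\<le>m. (m choose k) * card {f. L_chain (Suc k) f})"
proof -
  define n where "n = Suc (Suc m)"
  define rows where "rows g = (increasing_maps {g<..<n} {0<..<n - 1} :: (nat \<Rightarrow> nat) set)" for g
  have finite_rows: "finite (rows g)" for g
    unfolding rows_def by (intro finite_increasing_maps) auto
  have card_rows: "card (rows (Suc k)) = m choose k" if "k \<le> m" for k
    using that binomial_symmetric[OF that] by (simp add: rows_def card_increasing_maps n_def)
  have "card {f. L_chain n f} = card (SIGMA g:{0<..<n}. {h. L_chain g h} \<times> rows g)"
    unfolding rows_def using bij_betw_glue[of n] by (simp add: bij_betw_same_card n_def)
  also have "\<dots> = (\<Sum>g\<in>{0<..<n}. card {h. L_chain g h} * card (rows g))"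
    by (simp add: finite_L_chains finite_rows card_cartesian_product)
  also have "\<dots> = (\<Sum>k\<le>m. card {h. L_chain (Suc k) h} * card (rows (Suc k)))"
    by (rule sum.reindex_bij_witness[of _ Suc "\<lambda>g. g - 1"]) (auto simp: n_def)
  also have "\<dots> = (\<Sum>k\<le>m. (m choose k) * card {h. L_chain (Suc k) h})"
    by (intro sum.cong) (auto simp: card_rows)
  finally show ?thesis
    by (simp add: n_def)
qed

lemma L_chain_Suc_0_iff: "L_chain (Suc 0) f \<longleftrightarrow> f = (\<lambda>i k. 0)"
proof
  assume "L_chain (Suc 0) f"
  then interpret L_chain "Suc 0" f .
  have "f i k = 0" for i k
    using eq_0_iff[of i k] by linarith
  then show "f = (\<lambda>i k. 0)" by blast
qed (auto simp: L_chain_def)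

lemma card_L_chains: "card {f. L_chain (Suc m) f} = Bell m"
proof (induction m rule: less_induct)
  case (less m)
  show ?case
  proof (cases m)
    case 0
    then show ?thesis
      by (simp add: L_chain_Suc_0_iff Bell_0)
  next
    case (Suc p)
    then have "card {f. L_chain (Suc m) f} = (\<Sum>k\<le>p. (p choose k) * Bell k)"
      using less.IH by (simp add: card_L_chains_Suc_Suc)
    then show ?thesis
      by (simp add: Suc Bell_Suc)
  qed
qed

section \<open>Isomorphism classes\<close>

context L_chain
begin

lemma logical_unit_0: "0 < n \<Longrightarrow> logical_unit {..<n} f 0"
  by (simp add: logical_unit_def unit_left eq_0_iff)

lemma L_le_iff: "0 < n \<Longrightarrow> y < n \<Longrightarrow> L_le {..<n} f x y \<longleftrightarrow> y \<le> x"
  by (simp add: L_le_def L_unit_eq[OF logical_unit_0] eq_0_iff)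

lemma cycloid_le:
  assumes "x \<le> y" "y < n" "z < n"
  shows "f (f x y) (f x z) = f (f y x) (f y z)"
proof -
  have "f (f x y) (f x z) = f y z"
  proof (cases "y \<le> z")
    case True
    then show ?thesis
      using assms by (intro cycloid)
  next
    case False
    then have "f x z \<le> f x y" "f y z = 0"
      using assms by (auto simp: row_mono eq_0_iff)
    then show ?thesis
      using eq_0_iff[of "f x y" "f x z"] by simp
  qed
  also have "f y x = 0"
    using assms by (simp add: eq_0_iff)
  then have "f y z = f (f y x) (f y z)"
    using assms by (simp add: unit_left closed)
  finally show ?thesis .
qed

lemma linear_L_algebra:
  assumes "0 < n"
  shows "linear_L_algebra {..<n} f"
proof -
  have "f (f x y) (f x z) = f (f y x) (f y z)" if "x < n" "y < n" "z < n" for x y z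
    using that cycloid_le[of x y z] cycloid_le[of y x z] by (cases "x \<le> y") simp_all
  then have "L_algebra {..<n} f"
    unfolding L_algebra_def using logical_unit_0[OF assms] closed eq_0_iff
    by (intro conjI exI[of _ 0]) auto
  then show ?thesis
    using assms by (auto simp: linear_L_algebra_def L_le_iff)
qed

end

lemma L_chain_isomorphic_eq:
  assumes f: "L_chain n f" and f': "L_chain n f'"
    and iso: "L_isomorphic ({..<n}, f) ({..<n}, f')"
  shows "f = f'"
proof (intro ext)
  fix i k
  interpret f: L_chain n f by (rule f)
  interpret f': L_chain n f' by (rule f')
  obtain h where h: "bij_betw h {..<n} {..<n}"
    and hom: "\<And>x y. x < n \<Longrightarrow> y < n \<Longrightarrow> h (f x y) = f' (h x) (h y)"
    using iso by (auto simp: L_isomorphic_def)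
  have h_less: "h x < n" if "x < n" for x
    using bij_betw_apply[OF h] that by simp
  have h_0: "h 0 = 0" if "0 < n"
    using hom[OF that that] f.eq_0_iff[of 0 0] f'.eq_0_iff[of "h 0" "h 0"] by simp
  have "strict_mono_on {..<n} h"
  proof (rule strict_mono_onI)
    fix x y assume xy: "x \<in> {..<n}" "y \<in> {..<n}" "x < y"
    then have "f' (h y) (h x) = 0"
      using hom[of y x] h_0 f.eq_0_iff[of y x] by simp
    moreover have "h x \<noteq> h y"
      using xy bij_betw_imp_inj_on[OF h] by (auto dest: inj_onD)
    ultimately show "h x < h y"
      using xy h_less[of x] by (simp add: f'.eq_0_iff)
  qed
  then have h_id: "h x = x" if "x < n" for x
    using that bij_betw_imp_surj_on[OF h] strict_mono_on_ident
    by (intro strict_mono_on_eq_if_image_eq[of "{..<n}" h "\<lambda>x. x"]) auto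
  show "f i k = f' i k"
  proof (cases "k \<le> i \<or> n \<le> k")
    case True
    then show ?thesis
      using f.eq_0_iff[of i k] f'.eq_0_iff[of i k] by simp
  next
    case False
    then show ?thesis
      using hom[of i k] f.closed[of k i] h_id by simp
  qed
qed

lemma L_chain_transport:
  assumes X: "L_algebra X f" and s: "bij_betw s {..<n} X"
    and order: "\<And>i k. i < n \<Longrightarrow> k < n \<Longrightarrow> L_le X f (s i) (s k) \<longleftrightarrow> k \<le> i"
    and g_closed: "\<And>i k. k < n \<Longrightarrow> g i k < n"
    and g_outside: "\<And>i k. n \<le> i \<or> n \<le> k \<Longrightarrow> g i k = 0"
    and hom: "\<And>i k. i < n \<Longrightarrow> k < n \<Longrightarrow> s (g i k) = f (s i) (s k)"
  shows "L_chain n g"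
proof
  have s_mem: "s i \<in> X" if "i < n" for i
    using bij_betw_apply[OF s] that by simp
  have s_eq_iff: "s i = s k \<longleftrightarrow> i = k" if "i < n" "k < n" for i k
    using that inj_on_eq_iff[OF bij_betw_imp_inj_on[OF s]] by simp
  have s_0: "s 0 = L_unit X f" if "0 < n"
  proof -
    obtain j where "j < n" "s j = L_unit X f"
      using L_unit_mem[OF X] bij_betw_imp_surj_on[OF s] by auto
    then show ?thesis
      using order[of j 0] L_unit_left[OF X s_mem[OF that]] that by (simp add: L_le_def)
  qed
  show "g 0 k = k" if "k < n" for k
    using that hom[of 0 k] s_eq_iff g_closed s_0 L_unit_left[OF X] s_mem by auto
  show "g i k = 0 \<longleftrightarrow> k \<le> i \<or> n \<le> k" for i k
  proof (cases "i < n \<and> k < n")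
    case True
    then have "g i k = 0 \<longleftrightarrow> s (g i k) = L_unit X f"
      using s_eq_iff[of "g i k" 0] g_closed[of k i] s_0 by auto
    also have "\<dots> \<longleftrightarrow> k \<le> i"
      using True hom order by (simp add: L_le_def)
    finally show ?thesis
      using True by simp
  next
    case False
    then show ?thesis
      using g_outside[of i k] by auto
  qed
  show "g (g i j) (g i k) = g j k" if "i \<le> j" "j \<le> k" "k < n" for i j k
  proof -
    have "s (g (g i j) (g i k)) = f (f (s i) (s j)) (f (s i) (s k))"
      using that by (simp add: hom g_closed)
    also have "\<dots> = s (g j k)"
      using that by (simp add: L_algebra_cycloid_if_L_le[OF X] hom s_mem order)
    finally show ?thesis
      using that by (simp add: s_eq_iff g_closed)
  qed
qed (rule g_closed)

lemma ex_isomorphic_L_chain: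
  assumes X: "linear_L_algebra X f" and "finite X"
  shows "\<exists>g. L_chain (card X) g \<and> L_isomorphic ({..<card X}, g) (X, f)"
proof -
  have alg: "L_algebra X f"
    using X by (simp add: linear_L_algebra_def)
  let ?above = "{(x, y). x \<in> X \<and> y \<in> X \<and> L_le X f x y}\<inverse>"
  obtain s where s: "bij_betw s {..<card X} X"
    and above: "\<And>i k. i < card X \<Longrightarrow> k < card X \<Longrightarrow> (s i, s k) \<in> ?above \<longleftrightarrow> i \<le> k"
    using ex_linear_order_enumeration[OF \<open>finite X\<close>, of ?above] linear_order_on_L_le[OF X] by auto
  have s_mem: "s i \<in> X" if "i < card X" for i
    using bij_betw_apply[OF s] that by simp
  have order: "L_le X f (s i) (s k) \<longleftrightarrow> k \<le> i" if "i < card X" "k < card X" for i k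
    using above[of k i] that s_mem by simp
  define s_inv where "s_inv = inv_into {..<card X} s"
  have s_inv_mem: "s_inv x < card X" if "x \<in> X" for x
    using bij_betw_apply[OF bij_betw_inv_into[OF s]] that by (simp add: s_inv_def)
  define g where "g i k = (if i < card X \<and> k < card X then s_inv (f (s i) (s k)) else 0)" for i k
  have hom: "s (g i k) = f (s i) (s k)" if "i < card X" "k < card X" for i k
    using that L_algebra_closed[OF alg] s_mem by (simp add: g_def s_inv_def bij_betw_inv_into_right[OF s])
  have "L_chain (card X) g"
  proof (rule L_chain_transport[OF alg s order])
    show "g i k < card X" if "k < card X" for i k
      using that L_algebra_closed[OF alg] s_mem s_inv_mem by (simp add: g_def)
  qed (use hom in \<open>auto simp: g_def\<close>)
  moreover have "L_isomorphic ({..<card X}, g) (X, f)"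
    unfolding L_isomorphic_def using s hom by auto
  ultimately show ?thesis by blast
qed

lemma num_linear_L_algebras_eq_card_L_chains:
  assumes "0 < n"
  shows "num_linear_L_algebras n = card {f. L_chain n f}"
proof -
  let ?T = "Pair {..<n} ` {f. L_chain n f}"
  have T: "?T \<subseteq> linear_L_algebras n"
    using L_chain.linear_L_algebra assms by (auto simp: linear_L_algebras_def)
  have "card (linear_L_algebras n // L_iso_rel n) = card ?T"
  proof (rule card_quotient_eq_card_transversal[OF equiv_L_iso_rel T])
    show "A = B" if "A \<in> ?T" "B \<in> ?T" "(A, B) \<in> L_iso_rel n" for A B
      using that L_chain_isomorphic_eq by (auto simp: L_iso_rel_def)
    show "\<exists>B\<in>?T. (B, A) \<in> L_iso_rel n" if "A \<in> linear_L_algebras n" for A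
    proof -
      obtain X f where A: "A = (X, f)" "linear_L_algebra X f" "finite X" "card X = n"
        using \<open>A \<in> linear_L_algebras n\<close> by (auto simp: linear_L_algebras_def)
      then obtain g where "L_chain n g" "L_isomorphic ({..<n}, g) A"
        using ex_isomorphic_L_chain by blast
      moreover from this have "(({..<n}, g), A) \<in> L_iso_rel n"
        using that T by (auto simp: L_iso_rel_def)
      ultimately show ?thesis by blast
    qed
  qed
  also have "\<dots> = card {f. L_chain n f}"
    by (intro card_image inj_onI) simp
  finally show ?thesis
    by (simp add: num_linear_L_algebras_def)
qed

theorem theorem4p5:
  fixes n :: nat
  assumes "n \<ge> 1"
  shows "num_linear_L_algebras n = Bell (n - 1)"
proof -
  have "num_linear_L_algebras n = card {f. L_chain n f}"
    using assms by (intro num_linear_L_algebras_eq_card_L_chains) simp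
  also have "\<dots> = Bell (n - 1)"
    using assms card_L_chains[of "n - 1"] by simp
  finally show ?thesis .
qed

end
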